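(* Let $m\ge n\ge 0$ and $M\ge 1$ be integers and let $\lambda$ be a partition inside an $n\times m$ board ($n$ rows, $m$ columns). Then $$X_\lambda^{m+n}(M)=X_\lambda^{m+n}(M-1)+x_M\sum_{i=1}^{m+n}q^{m+n-i-\lambda_i'}\,X^{m+n-1}_{\lambda/i}(M-1)+x_M^2\sum_{(i,j)\in\lambda}q^{\,i-1+(m+n-j-\lambda_j')}\,X^{m+n-2}_{\lambda/(i,j)}(M-1),$$ where $\lambda/(i,j)$ is the partition obtained from $\lambda$ by removing row $i$ and column $j$, and $\lambda/i$ is the partition obtained from $\lambda$ by removing column $i$ if $1\le i\le m$, or by removing row $m+n-i+1$ if $m+1\le i\le m+n$.
   Context: Boards and partitions: cell $(i,j)$ is in row $i$ from the top and column $j$ from the left. A partition $\lambda=(\lambda_1\ge\cdots\ge\lambda_n\ge 0)$ with $\lambda_1\le m$ is identified with the set of cells $(i,j)$ with $j\le\lambda_i$. $\lambda'_j$ is the number of cells in column $j$ of $\lambda$ (the conjugate partition), so $\lambda'_j=0$ for $j>\lambda_1$. Graph of $\lambda$: for $\lambda$ inside an $n\times m$ board and $N=m+n$, $G(\lambda)$ has vertices $1,\dots,N$; all pairs $a<b$ are edges except that each cell $(i,a)\in\lambda$ gives the non-edge $\{a,N+1-i\}$. (This depends only on $\lambda$ and $N$, and is the graph of the abelian Dyck path $\mathsf{n}^m w(\lambda)\mathsf{e}^n$.) Chromatic polynomial in $M$ variables: $X_\lambda^{N}(M)=\sum_\kappa q^{\mathrm{asc}(\kappa)}\prod_v x_{\kappa(v)}\in\mathbb{Z}[q][x_1,\dots,x_M]$,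 the sum over proper colorings $\kappa:\{1,\dots,N\}\to\{1,\dots,M\}$ of the graph $G(\lambda)$ on $N$ vertices, where $\mathrm{asc}(\kappa)$ is the number of edges $\{a,b\}$ with $a<b$ and $\kappa(a)<\kappa(b)$. For $N=0$ it equals $1$. *)

theory Defs
  imports
    "HOL-Library.Poly_Mapping"
    "HOL-Library.FuncSet"
    "HOL-Computational_Algebra.Polynomial"
begin

text \<open>
  A partition with n parts, zero parts allowed, is the list of its parts, so the part in row i
  (rows are numbered from 1) is \<open>la ! (i - 1)\<close>.
\<close>

definition partition_in_board :: "nat \<Rightarrow> nat \<Rightarrow> nat list \<Rightarrow> bool" where
  "partition_in_board n m la \<longleftrightarrow> length la = n \<and> sorted_wrt (\<ge>) la \<and> (\<forall>p\<in>set la. p \<le> m)"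

definition cells :: "nat list \<Rightarrow> (nat \<times> nat) set" where
  "cells la = {(i, j). i \<in> {1..length la} \<and> j \<in> {1..la ! (i - 1)}}"

definition conj_part :: "nat list \<Rightarrow> nat \<Rightarrow> nat" where
  "conj_part la j = card {i. (i, j) \<in> cells la}"

definition remove_row :: "nat \<Rightarrow> nat list \<Rightarrow> nat list" where
  "remove_row i la = take (i - 1) la @ drop i la"

text \<open>Only the rows that reach column j lose a cell.\<close>

definition remove_column :: "nat \<Rightarrow> nat list \<Rightarrow> nat list" where
  "remove_column j la = map (\<lambda>p. if j \<le> p then p - 1 else p) la"

definition remove_cell_lines :: "nat list \<Rightarrow> nat \<times> nat \<Rightarrow> nat list" where
  "remove_cell_lines la c = remove_row (fst c) (remove_column (snd c) la)"

definition remove_line :: "nat \<Rightarrow> nat \<Rightarrow> nat list \<Rightarrow> nat \<Rightarrow> nat list" where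
  "remove_line n m la i =
     (if i \<le> m then remove_column i la else remove_row (m + n - i + 1) la)"

definition graph_edges :: "nat \<Rightarrow> nat list \<Rightarrow> nat set set" where
  "graph_edges N la =
     {{a, b} | a b. 1 \<le> a \<and> a < b \<and> b \<le> N} - {{a, N + 1 - i} | i a. (i, a) \<in> cells la}"

definition proper_colorings :: "nat \<Rightarrow> nat list \<Rightarrow> nat \<Rightarrow> (nat \<Rightarrow> nat) set" where
  "proper_colorings N la M =
     {\<kappa> \<in> {1..N} \<rightarrow>\<^sub>E {1..M}. \<forall>a b. {a, b} \<in> graph_edges N la \<longrightarrow> \<kappa> a \<noteq> \<kappa> b}"

definition asc :: "nat \<Rightarrow> nat list \<Rightarrow> (nat \<Rightarrow> nat) \<Rightarrow> nat" where
  "asc N la \<kappa> = card {(a, b). {a, b} \<in> graph_edges N la \<and> a < b \<and> \<kappa> a < \<kappa> b}"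

text \<open>
  Polynomials over \<open>\<int>[q]\<close> in variables indexed by the naturals: finitely supported maps from
  exponent vectors to coefficients, with convolution as multiplication.
\<close>

type_synonym qpoly = "(nat \<Rightarrow>\<^sub>0 nat) \<Rightarrow>\<^sub>0 int poly"

definition qvar :: qpoly where
  "qvar = Poly_Mapping.single 0 (monom 1 1)"

definition xvar :: "nat \<Rightarrow> qpoly" where
  "xvar i = Poly_Mapping.single (Poly_Mapping.single i 1) 1"

definition chrom :: "nat \<Rightarrow> nat list \<Rightarrow> nat \<Rightarrow> qpoly" where
  "chrom N la M =
     (\<Sum>\<kappa>\<in>proper_colorings N la M. qvar ^ asc N la \<kappa> * (\<Prod>v\<in>{1..N}. xvar (\<kappa> v)))"

end

theory Submission
  imports Defs
begin

text \<open>
  Sort the colorings by the class \<open>S\<close> of one extreme color. In the graph of a partition the column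
  vertices \<open>1, \<dots>, m\<close> form a clique and so do the row vertices \<open>m + 1, \<dots>, m + n\<close>, so an independent
  set \<open>S\<close> is empty, a single vertex, or a pair \<open>{j, m + n + 1 - i}\<close> for a cell \<open>(i, j)\<close>
  (\<open>independent_sets\<close>). Deleting \<open>S\<close> leaves the graph of the partition without the corresponding
  rows and columns, up to the increasing relabelling of the vertices. These three kinds of sets give
  the three terms of the identity.

  The powers of \<open>q\<close> in the identity count the edges from \<open>S\<close> to larger vertices (\<open>up_edges_vertex\<close>,
  \<open>up_edges_cell\<close>), which are the ascents produced when \<open>S\<close> is the class of the lowest color, whereas
  the variable that is split off belongs to the highest color \<open>M\<close>. The two are reconciled by the
  symmetry of the chromatic polynomial in its variables. For this the polynomial is
  written as \<open>class_sum\<close>, a sum with one weight per color that peels off color classes from the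
  lowest color upwards (\<open>colorings_eq_class_sum\<close>), and two neighbouring weights are shown to
  commute (\<open>class_sum_swap\<close>); then the last weight can be moved to the front (\<open>class_sum_rotate\<close>).

  Two neighbouring weights commute because, on the set \<open>U\<close> of the vertices that receive one of the
  two colors, the colorings can be rearranged so that the class sizes are swapped and the number of
  ascents is kept (\<open>bipartitions_swap\<close>). Since both classes have at most two elements, this is
  immediate unless \<open>U\<close> has three elements, and that case is checked by hand (\<open>bipartitions_three\<close>).
\<close>

section \<open>Chromatic polynomials with a list of weights\<close>

text \<open>
  Graphs on a linearly ordered vertex type are given by a relation \<open>E\<close> whose value \<open>E a b\<close> is
  consulted only for \<open>a < b\<close>; it need not be symmetric.
\<close>

definition independent :: "('v::linorder \<Rightarrow> 'v \<Rightarrow> bool) \<Rightarrow> 'v set \<Rightarrow> bool" where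
  "independent E S \<longleftrightarrow> (\<forall>a\<in>S. \<forall>b\<in>S. a < b \<longrightarrow> \<not> E a b)"

text \<open>The number of edges \<open>{a, b}\<close> with \<open>a \<in> S\<close>, \<open>b \<in> T\<close> and \<open>a < b\<close>.\<close>

definition up_edges :: "('v::linorder \<Rightarrow> 'v \<Rightarrow> bool) \<Rightarrow> 'v set \<Rightarrow> 'v set \<Rightarrow> nat" where
  "up_edges E S T = (\<Sum>a\<in>S. \<Sum>b\<in>T. of_bool (a < b \<and> E a b))"

text \<open>
  The chromatic polynomial of the graph on \<open>V\<close> whose colors carry the weights in the list, the lowest
  color first: \<open>S\<close> is the class of the lowest color, and its edges to larger vertices are the ascents
  that start in \<open>S\<close>.
\<close>

primrec class_sum ::
  "('v::linorder \<Rightarrow> 'v \<Rightarrow> bool) \<Rightarrow> 'a::comm_semiring_1 \<Rightarrow> 'a list \<Rightarrow> 'v set \<Rightarrow> 'a" where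
  "class_sum E q [] V = of_bool (V = {})"
| "class_sum E q (y # ys) V =
     (\<Sum>S\<in>{S. S \<subseteq> V \<and> independent E S}.
        q ^ up_edges E S (V - S) * y ^ card S * class_sum E q ys (V - S))"

text \<open>
  The first conjunct says that no three vertices are successively non-adjacent, so that independent
  sets have at most two elements; the second, that an edge \<open>{a, c}\<close> makes every vertex between
  \<open>a\<close> and \<open>c\<close> adjacent to both, as in a natural unit interval graph.
\<close>

definition co_bipartite_interval :: "('v::linorder \<Rightarrow> 'v \<Rightarrow> bool) \<Rightarrow> 'v set \<Rightarrow> bool" where
  "co_bipartite_interval E V \<longleftrightarrow>
     (\<forall>a\<in>V. \<forall>b\<in>V. \<forall>c\<in>V. a < b \<longrightarrow> b < c \<longrightarrow>
        (E a b \<or> E b c) \<and> (E a c \<longrightarrow> E a b \<and> E b c))"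

lemma co_bipartite_interval_subset:
  "co_bipartite_interval E V \<Longrightarrow> U \<subseteq> V \<Longrightarrow> co_bipartite_interval E U"
  unfolding co_bipartite_interval_def by blast

lemma up_edges_Un_left:
  assumes "finite S" "finite S'" "S \<inter> S' = {}"
  shows "up_edges E (S \<union> S') T = up_edges E S T + up_edges E S' T"
  using assms by (simp add: up_edges_def sum.union_disjoint)

lemma up_edges_Un_right:
  assumes "finite T" "finite T'" "T \<inter> T' = {}"
  shows "up_edges E S (T \<union> T') = up_edges E S T + up_edges E S T'"
  unfolding up_edges_def using assms by (simp only: sum.union_disjoint sum.distrib)

lemma up_edges_image:
  assumes "strict_mono_on V f" "S \<subseteq> V" "T \<subseteq> V"
    and "\<And>a b. a \<in> V \<Longrightarrow> b \<in> V \<Longrightarrow> a < b \<Longrightarrow> E' (f a) (f b) = E a b"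
  shows "up_edges E' (f ` S) (f ` T) = up_edges E S T"
proof -
  have inj: "inj_on f V"
    using assms(1) by (rule strict_mono_on_imp_inj_on)
  have "up_edges E' (f ` S) (f ` T) = (\<Sum>a\<in>S. \<Sum>b\<in>T. of_bool (f a < f b \<and> E' (f a) (f b)))"
    unfolding up_edges_def
    using inj_on_subset[OF inj assms(2)] inj_on_subset[OF inj assms(3)]
    by (simp add: sum.reindex)
  also have "\<dots> = up_edges E S T"
    unfolding up_edges_def
  proof (intro sum.cong refl)
    fix a b assume "a \<in> S" "b \<in> T"
    then have "a \<in> V" "b \<in> V" using assms by auto
    moreover from this have "f a < f b \<longleftrightarrow> a < b"
      using assms(1) by (metis linorder_less_linear order_less_asym strict_mono_onD)
    ultimately show "(of_bool (f a < f b \<and> E' (f a) (f b)) :: nat) = of_bool (a < b \<and> E a b)"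
      using assms(4) by auto
  qed
  finally show ?thesis .
qed

lemma independent_image:
  assumes "strict_mono_on V f" "S \<subseteq> V"
    and "\<And>a b. a \<in> V \<Longrightarrow> b \<in> V \<Longrightarrow> a < b \<Longrightarrow> E' (f a) (f b) = E a b"
  shows "independent E' (f ` S) \<longleftrightarrow> independent E S"
proof -
  have "f a < f b \<longleftrightarrow> a < b" if "a \<in> S" "b \<in> S" for a b
    using assms(1,2) that by (metis linorder_less_linear order_less_asym strict_mono_onD subsetD)
  moreover have "E' (f a) (f b) \<longleftrightarrow> E a b" if "a \<in> S" "b \<in> S" "a < b" for a b
    using assms(2,3) that by blast
  ultimately show ?thesis
    unfolding independent_def by auto
qed

text \<open>Invariance under increasing relabelling of the vertices.\<close>

lemma class_sum_image:
  assumes "strict_mono_on V f"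
    and "\<And>a b. a \<in> V \<Longrightarrow> b \<in> V \<Longrightarrow> a < b \<Longrightarrow> E' (f a) (f b) = E a b"
  shows "class_sum E' q ys (f ` V) = class_sum E q ys V"
  using assms
proof (induction ys arbitrary: V)
  case Nil
  then show ?case by simp
next
  case (Cons y ys)
  have inj: "inj_on f V"
    using Cons.prems(1) by (rule strict_mono_on_imp_inj_on)
  have img: "{S. S \<subseteq> f ` V \<and> independent E' S} = (`) f ` {S. S \<subseteq> V \<and> independent E S}"
  proof -
    have "independent E' (f ` S) \<longleftrightarrow> independent E S" if "S \<subseteq> V" for S
      using Cons.prems that by (intro independent_image) auto
    then show ?thesis
      by (auto simp: subset_image_iff)
  qed
  have inj2: "inj_on ((`) f) {S. S \<subseteq> V \<and> independent E S}"
    using inj by (auto intro!: inj_onI simp: inj_on_image_eq_iff)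
  show ?case
    unfolding class_sum.simps img sum.reindex[OF inj2] comp_def
  proof (intro sum.cong refl)
    fix S assume "S \<in> {S. S \<subseteq> V \<and> independent E S}"
    then have S: "S \<subseteq> V" by simp
    have diff: "f ` V - f ` S = f ` (V - S)"
      using inj S by (simp add: inj_on_image_set_diff)
    have "class_sum E' q ys (f ` (V - S)) = class_sum E q ys (V - S)"
      using Cons.prems by (intro Cons.IH) (auto simp: strict_mono_on_def)
    moreover have "up_edges E' (f ` S) (f ` (V - S)) = up_edges E S (V - S)"
      using S Cons.prems by (intro up_edges_image) auto
    moreover have "card (f ` S) = card S"
      using inj S by (meson card_image inj_on_subset)
    ultimately show "q ^ up_edges E' (f ` S) (f ` V - f ` S) * y ^ card (f ` S)
          * class_sum E' q ys (f ` V - f ` S)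
        = q ^ up_edges E S (V - S) * y ^ card S * class_sum E q ys (V - S)"
      by (simp add: diff)
  qed
qed

section \<open>Symmetry in the weights\<close>

lemma card_independent_le_2:
  assumes "co_bipartite_interval E V" "independent E S" "S \<subseteq> V" "finite S"
  shows "card S \<le> 2"
proof (rule ccontr)
  assume "\<not> card S \<le> 2"
  then have "3 \<le> card S" by simp
  then obtain T where T: "T \<subseteq> S" "card T = 3"
    by (metis obtain_subset_with_card_n)
  define l where "l = sorted_list_of_set T"
  have "finite T" using T assms(4) finite_subset by blast
  then have l: "sorted_wrt (<) l" "set l = T" "length l = 3"
    using T by (simp_all add: l_def)
  then obtain a b c where "l = [a, b, c]"
    by (auto simp: numeral_3_eq_3 length_Suc_conv)
  then have "a < b" "b < c" "a \<in> S" "b \<in> S" "c \<in> S"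
    using l T by auto
  then show False
    using assms(1-3) unfolding co_bipartite_interval_def independent_def by blast
qed

text \<open>
  The proper colorings of \<open>U\<close> with two colors, each given by the class of its lower color.
\<close>

definition bipartitions :: "('v::linorder \<Rightarrow> 'v \<Rightarrow> bool) \<Rightarrow> 'v set \<Rightarrow> 'v set set" where
  "bipartitions E U = {S. S \<subseteq> U \<and> independent E S \<and> independent E (U - S)}"

lemma finite_bipartitions: "finite U \<Longrightarrow> finite (bipartitions E U)"
  by (simp add: bipartitions_def)

lemma bipartitions_compl: "S \<in> bipartitions E U \<Longrightarrow> U - S \<in> bipartitions E U"
  by (auto simp: bipartitions_def double_diff)

lemma sum_Pow_insert:
  assumes "finite A" "a \<notin> A"
  shows "(\<Sum>S\<in>Pow (insert a A). g S) = (\<Sum>S\<in>Pow A. g S) + (\<Sum>S\<in>Pow A. g (insert a S))"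
proof -
  have "inj_on (insert a) (Pow A)"
    using assms(2) by (auto intro!: inj_onI simp: insert_ident subset_iff)
  moreover have "Pow A \<inter> insert a ` Pow A = {}"
    using assms(2) by auto
  ultimately show ?thesis
    using assms(1) by (simp add: Pow_insert sum.union_disjoint sum.reindex)
qed

text \<open>
  The two sums run over the same classes \<open>S\<close>, with \<open>S\<close> colored by the lower color on the left and by
  the higher color on the right.
\<close>

lemma bipartitions_three:
  fixes y z q :: "'a::comm_semiring_1"
  assumes "a < b" "b < c" "co_bipartite_interval E {a, b, c}"
  shows "(\<Sum>S\<in>bipartitions E {a, b, c}.
            q ^ up_edges E S ({a, b, c} - S) * y ^ card S * z ^ card ({a, b, c} - S))
       = (\<Sum>S\<in>bipartitions E {a, b, c}.
            q ^ up_edges E ({a, b, c} - S) S * y ^ card S * z ^ card ({a, b, c} - S))"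
proof -
  have ord: "a < b" "b < c" "a < c" "\<not> b < a" "\<not> c < a" "\<not> c < b"
    and ne: "a \<noteq> b" "b \<noteq> a" "a \<noteq> c" "c \<noteq> a" "b \<noteq> c" "c \<noteq> b"
    using assms(1,2) by auto
  have edges: "E a b \<or> E b c" "E a c \<Longrightarrow> E a b" "E a c \<Longrightarrow> E b c"
    using assms unfolding co_bipartite_interval_def by blast+
  have eq: "(\<Sum>S\<in>bipartitions E {a, b, c}. g S)
      = (\<Sum>S\<in>Pow {a, b, c}. if independent E S \<and> independent E ({a, b, c} - S) then g S else 0)"
    for g :: "'b set \<Rightarrow> 'a"
  proof -
    have "bipartitions E {a, b, c}
        = Pow {a, b, c} \<inter> {S. independent E S \<and> independent E ({a, b, c} - S)}"
      by (auto simp: bipartitions_def)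
    then show ?thesis
      by (simp only: sum.inter_restrict mem_Collect_eq finite_Pow_iff finite.intros)
  qed
  have diff: "{a, b, c} - {a} = {b, c}" "{a, b, c} - {b} = {a, c}" "{a, b, c} - {c} = {a, b}"
    "{a, b, c} - {a, b} = {c}" "{a, b, c} - {a, c} = {b}" "{a, b, c} - {b, c} = {a}"
    using ne by auto
  have ind: "independent E {a, b} \<longleftrightarrow> \<not> E a b" "independent E {a, c} \<longleftrightarrow> \<not> E a c"
    "independent E {b, c} \<longleftrightarrow> \<not> E b c"
    "\<And>v. independent E {v}" "\<not> independent E {a, b, c}"
    using ord edges by (auto simp: independent_def)
  have up: "up_edges E {a} {b, c} = of_bool (E a b) + of_bool (E a c)"
    "up_edges E {b} {a, c} = of_bool (E b c)" "up_edges E {c} {a, b} = 0"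
    "up_edges E {b, c} {a} = 0" "up_edges E {a, c} {b} = of_bool (E a b)"
    "up_edges E {a, b} {c} = of_bool (E a c) + of_bool (E b c)"
    using ord ne by (simp_all add: up_edges_def)
  have pow: "(\<Sum>S\<in>Pow {a, b, c}. g S)
      = g {} + g {c} + (g {b} + g {b, c}) + (g {a} + g {a, c} + (g {a, b} + g {a, b, c}))"
    for g :: "'b set \<Rightarrow> 'a"
    using ne by (simp add: sum_Pow_insert del: Pow_insert)
  \<comment> \<open>The path \<open>a - b - c\<close> has one ascent on both sides. If the only edge is \<open>{a, b}\<close>
      or \<open>{b, c}\<close>, the terms are matched by exchanging its two ends.\<close>
  show ?thesis
    unfolding eq pow diff ind up
    using edges ne by (cases "E a b"; cases "E b c"; cases "E a c") (simp_all add: ind ac_simps)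
qed

text \<open>
  Exchanging the two classes proves this when they have the same size. Otherwise, if \<open>U\<close> does not
  have three elements, one of them is empty and there are no edges between them.
\<close>

lemma bipartitions_swap:
  fixes y z q :: "'a::comm_semiring_1"
  assumes "finite U" "co_bipartite_interval E U"
  shows "(\<Sum>S\<in>bipartitions E U. q ^ up_edges E S (U - S) * y ^ card S * z ^ card (U - S))
       = (\<Sum>S\<in>bipartitions E U. q ^ up_edges E (U - S) S * y ^ card S * z ^ card (U - S))"
proof (cases "card U = 3")
  case True
  define l where "l = sorted_list_of_set U"
  have l: "sorted_wrt (<) l" "set l = U" "length l = 3"
    using assms True by (simp_all add: l_def)
  then obtain a b c where "l = [a, b, c]"
    by (auto simp: numeral_3_eq_3 length_Suc_conv)
  then have "a < b" "b < c" "U = {a, b, c}"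
    using l by auto
  then show ?thesis
    using bipartitions_three assms(2) by blast
next
  case False
  define f where "f S = (if card S = card (U - S) then U - S else S)" for S
  have inv: "f (f S) = S" "f S \<in> bipartitions E U" if "S \<in> bipartitions E U" for S
    using that by (auto simp: f_def bipartitions_def double_diff)
  have main: "up_edges E (U - f S) (f S) = up_edges E S (U - S) \<and> card (f S) = card S
      \<and> card (U - f S) = card (U - S)"
    if S: "S \<in> bipartitions E U" for S
  proof (cases "card S = card (U - S)")
    case True
    then show ?thesis
      using S by (simp add: f_def bipartitions_def double_diff)
  next
    case neq: False
    have sub: "S \<subseteq> U" "independent E S" "independent E (U - S)"
      using S by (auto simp: bipartitions_def)
    then have fin: "finite S" "finite (U - S)"
      using assms(1) finite_subset by auto
    have "card S \<le> 2" "card (U - S) \<le> 2"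
      using sub fin assms by (auto intro: card_independent_le_2)
    moreover have "card S + card (U - S) \<noteq> 3"
      using False sub assms(1) by (simp add: card_Diff_subset card_mono fin)
    ultimately have "card S = 0 \<or> card (U - S) = 0"
      using neq by linarith
    then have "S = {} \<or> S = U"
      using fin sub(1) by auto
    then show ?thesis
      using neq by (auto simp: f_def up_edges_def)
  qed
  show ?thesis
    by (rule sum.reindex_bij_witness[where i = f and j = f]) (simp_all add: inv main)
qed

text \<open>
  The classes of the two lowest colors are collected into their union \<open>U\<close>.
\<close>

lemma class_sum_two:
  fixes y z q :: "'a::comm_semiring_1"
  assumes "finite V"
  shows "class_sum E q (y # z # ys) V
       = (\<Sum>U\<in>Pow V. q ^ up_edges E U (V - U) * class_sum E q ys (V - U)
            * (\<Sum>S\<in>bipartitions E U. q ^ up_edges E S (U - S) * y ^ card S * z ^ card (U - S)))"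
proof -
  let ?I = "\<lambda>V. {S. S \<subseteq> V \<and> independent E S}"
  let ?h = "\<lambda>S T. q ^ up_edges E S (V - S) * y ^ card S
      * (q ^ up_edges E T (V - S - T) * z ^ card T * class_sum E q ys (V - S - T))"
  let ?g = "\<lambda>U S. q ^ up_edges E U (V - U) * class_sum E q ys (V - U)
      * (q ^ up_edges E S (U - S) * y ^ card S * z ^ card (U - S))"
  have fin: "finite U" if "U \<subseteq> V" for U
    using that assms finite_subset by blast
  have "class_sum E q (y # z # ys) V = (\<Sum>S\<in>?I V. \<Sum>T\<in>?I (V - S). ?h S T)"
    by (simp add: sum_distrib_left)
  also have "\<dots> = (\<Sum>(S, T)\<in>Sigma (?I V) (\<lambda>S. ?I (V - S)). ?h S T)"
    using assms by (intro sum.Sigma) auto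
  also have "\<dots> = (\<Sum>(U, S)\<in>Sigma (Pow V) (bipartitions E). ?g U S)"
  proof (rule sum.reindex_bij_witness[where i = "\<lambda>(U, S). (S, U - S)" and j = "\<lambda>(S, T). (S \<union> T, S)"])
    fix p assume "p \<in> Sigma (?I V) (\<lambda>S. ?I (V - S))"
    then obtain S T where p: "p = (S, T)" and ST: "S \<subseteq> V" "T \<subseteq> V - S"
      "independent E S" "independent E T"
      by auto
    have dT: "S \<union> T - S = T" using ST by auto
    show "(case case p of (S, T) \<Rightarrow> (S \<union> T, S) of (U, S) \<Rightarrow> (S, U - S)) = p"
      using p dT by simp
    show "(case p of (S, T) \<Rightarrow> (S \<union> T, S)) \<in> Sigma (Pow V) (bipartitions E)"
      using p dT ST by (auto simp: bipartitions_def)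
    define R where "R = V - (S \<union> T)"
    have fins: "finite S" "finite T" "finite R"
      using ST fin[of S] fin[of T] fin[of R] by (auto simp: R_def)
    have VS: "V - S = T \<union> R" "T \<union> R - T = R"
      using ST by (auto simp: R_def)
    \<comment> \<open>Both sides count the edges going up from \<open>S\<close> to \<open>T\<close>, from \<open>S\<close> to \<open>R\<close> and from \<open>T\<close> to \<open>R\<close>.\<close>
    have "up_edges E S (T \<union> R) + up_edges E T R = up_edges E (S \<union> T) R + up_edges E S T"
    proof -
      have "up_edges E S (T \<union> R) = up_edges E S T + up_edges E S R"
        using fins by (intro up_edges_Un_right) (auto simp: R_def)
      moreover have "up_edges E (S \<union> T) R = up_edges E S R + up_edges E T R"
        using fins ST by (intro up_edges_Un_left) auto
      ultimately show ?thesis by simp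
    qed
    then have "q ^ up_edges E S (T \<union> R) * q ^ up_edges E T R
        = q ^ up_edges E (S \<union> T) R * q ^ up_edges E S T"
      by (simp flip: power_add)
    then have "q ^ up_edges E (S \<union> T) R * class_sum E q ys R
          * (q ^ up_edges E S T * y ^ card S * z ^ card T)
        = q ^ up_edges E S (T \<union> R) * y ^ card S
          * (q ^ up_edges E T R * z ^ card T * class_sum E q ys R)"
      by (metis (no_types, lifting) mult.assoc mult.commute mult.left_commute)
    then show "(case case p of (S, T) \<Rightarrow> (S \<union> T, S) of (U, S) \<Rightarrow> ?g U S) = (case p of (S, T) \<Rightarrow> ?h S T)"
      unfolding p prod.case dT VS by (simp only: R_def)
  next
    fix p assume "p \<in> Sigma (Pow V) (bipartitions E)"
    then obtain U S where "p = (U, S)" "U \<subseteq> V" "S \<subseteq> U" "independent E S" "independent E (U - S)"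
      by (auto simp: bipartitions_def)
    moreover from this have "S \<subseteq> V" "U - S \<subseteq> V - S" "S \<union> (U - S) = U" by auto
    ultimately show "(case case p of (U, S) \<Rightarrow> (S, U - S) of (S, T) \<Rightarrow> (S \<union> T, S)) = p"
      and "(case p of (U, S) \<Rightarrow> (S, U - S)) \<in> Sigma (?I V) (\<lambda>S. ?I (V - S))"
      by simp_all
  qed
  also have "\<dots> = (\<Sum>U\<in>Pow V. \<Sum>S\<in>bipartitions E U. ?g U S)"
    using assms fin by (intro sum.Sigma[symmetric]) (auto intro: finite_bipartitions)
  finally show ?thesis
    by (simp add: sum_distrib_left)
qed

lemma class_sum_swap:
  fixes y z q :: "'a::comm_semiring_1"
  assumes "finite V" "co_bipartite_interval E V"
  shows "class_sum E q (y # z # ys) V = class_sum E q (z # y # ys) V"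
proof -
  have "(\<Sum>S\<in>bipartitions E U. q ^ up_edges E S (U - S) * y ^ card S * z ^ card (U - S))
      = (\<Sum>S\<in>bipartitions E U. q ^ up_edges E S (U - S) * z ^ card S * y ^ card (U - S))"
    if "U \<in> Pow V" for U
  proof -
    have U: "finite U" "co_bipartite_interval E U"
      using that assms finite_subset co_bipartite_interval_subset by auto
    have "(\<Sum>S\<in>bipartitions E U. q ^ up_edges E S (U - S) * y ^ card S * z ^ card (U - S))
        = (\<Sum>S\<in>bipartitions E U. q ^ up_edges E (U - S) S * y ^ card S * z ^ card (U - S))"
      using U by (rule bipartitions_swap)
    also have "\<dots> = (\<Sum>S\<in>bipartitions E U. q ^ up_edges E S (U - S) * z ^ card S * y ^ card (U - S))"
      by (rule sum.reindex_bij_witness[where i = "\<lambda>S. U - S" and j = "\<lambda>S. U - S"])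
         (auto simp: bipartitions_compl, auto simp: bipartitions_def double_diff ac_simps)
    finally show ?thesis .
  qed
  then show ?thesis
    unfolding class_sum_two[OF assms(1)] by (intro sum.cong refl) simp
qed

lemma class_sum_rotate:
  fixes q :: "'a::comm_semiring_1"
  assumes "finite V" "co_bipartite_interval E V"
  shows "class_sum E q (ys @ [y]) V = class_sum E q (y # ys) V"
  using assms
proof (induction ys arbitrary: V)
  case Nil
  then show ?case by simp
next
  case (Cons z ys)
  have "class_sum E q ((z # ys) @ [y]) V = class_sum E q (z # y # ys) V"
    using Cons.prems Cons.IH co_bipartite_interval_subset[OF Cons.prems(2)]
    by (simp del: class_sum.simps(2) add: class_sum.simps(2)[of E q z])
  also have "\<dots> = class_sum E q (y # z # ys) V"
    using Cons.prems by (rule class_sum_swap)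
  finally show ?case .
qed

section \<open>Colorings\<close>

text \<open>
  Proper colorings and their ascents for a graph given by a relation on ordered vertices.
\<close>

definition colorings :: "('v::linorder \<Rightarrow> 'v \<Rightarrow> bool) \<Rightarrow> 'v set \<Rightarrow> nat set \<Rightarrow> ('v \<Rightarrow> nat) set" where
  "colorings E V C = {\<kappa> \<in> V \<rightarrow>\<^sub>E C. \<forall>a\<in>V. \<forall>b\<in>V. a < b \<and> E a b \<longrightarrow> \<kappa> a \<noteq> \<kappa> b}"

definition ascents :: "('v::linorder \<Rightarrow> 'v \<Rightarrow> bool) \<Rightarrow> 'v set \<Rightarrow> ('v \<Rightarrow> nat) \<Rightarrow> nat" where
  "ascents E V \<kappa> = (\<Sum>a\<in>V. \<Sum>b\<in>V. of_bool (a < b \<and> E a b \<and> \<kappa> a < \<kappa> b))"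

lemma finite_colorings: "finite V \<Longrightarrow> finite C \<Longrightarrow> finite (colorings E V C)"
  by (simp add: colorings_def finite_PiE)

lemma ascents_lowest_class:
  assumes "finite V" "S \<subseteq> V" "\<And>v. v \<in> S \<Longrightarrow> \<kappa> v = k" "\<And>v. v \<in> V - S \<Longrightarrow> k < \<kappa> v"
  shows "ascents E V \<kappa> = up_edges E S (V - S) + ascents E (V - S) \<kappa>"
proof -
  have split: "(\<Sum>b\<in>V. g b) = (\<Sum>b\<in>S. g b) + (\<Sum>b\<in>V - S. g b)" for g :: "_ \<Rightarrow> nat"
    using assms by (metis add.commute sum.subset_diff)
  have low: "(\<Sum>b\<in>V. of_bool (a < b \<and> E a b \<and> \<kappa> a < \<kappa> b))
      = (\<Sum>b\<in>V - S. of_bool (a < b \<and> E a b) :: nat)" if "a \<in> S" for a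
    unfolding split using assms that by (auto intro!: sum.cong)
  have high: "(\<Sum>b\<in>V. of_bool (a < b \<and> E a b \<and> \<kappa> a < \<kappa> b))
      = (\<Sum>b\<in>V - S. of_bool (a < b \<and> E a b \<and> \<kappa> a < \<kappa> b) :: nat)" if "a \<in> V - S" for a
    unfolding split using assms(3) assms(4)[OF that] by auto
  have "ascents E V \<kappa> = (\<Sum>a\<in>S. \<Sum>b\<in>V. of_bool (a < b \<and> E a b \<and> \<kappa> a < \<kappa> b))
      + (\<Sum>a\<in>V - S. \<Sum>b\<in>V. of_bool (a < b \<and> E a b \<and> \<kappa> a < \<kappa> b))"
    unfolding ascents_def by (rule split)
  then show ?thesis
    unfolding up_edges_def ascents_def using low high by simp
qed

lemma colorings_eq_class_sum:
  fixes q :: "'a::comm_semiring_1"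
  assumes "finite V" "k \<le> Suc M"
  shows "(\<Sum>\<kappa>\<in>colorings E V {k..M}. q ^ ascents E V \<kappa> * (\<Prod>v\<in>V. x (\<kappa> v)))
       = class_sum E q (map x [k..<Suc M]) V"
  using assms
proof (induction "Suc M - k" arbitrary: k V)
  case 0
  then have "k = Suc M" by simp
  have "colorings E V {k..M} = (if V = {} then {\<lambda>_. undefined} else {})"
    using \<open>k = Suc M\<close> by (auto simp: colorings_def PiE_eq_empty_iff)
  then show ?case
    using \<open>k = Suc M\<close> by (simp add: ascents_def)
next
  case (Suc d)
  then have kM: "k \<le> M" by simp
  let ?I = "{S. S \<subseteq> V \<and> independent E S}"
  let ?C = "\<lambda>S. colorings E (V - S) {Suc k..M}"
  let ?w = "\<lambda>V \<kappa>. q ^ ascents E V \<kappa> * (\<Prod>v\<in>V. x (\<kappa> v))"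
  have IH: "(\<Sum>\<kappa>\<in>?C S. ?w (V - S) \<kappa>) = class_sum E q (map x [Suc k..<Suc M]) (V - S)" for S
    using Suc kM by (intro Suc.hyps(1)) auto
  have "(\<Sum>\<kappa>\<in>colorings E V {k..M}. ?w V \<kappa>)
      = (\<Sum>(S, \<kappa>)\<in>Sigma ?I ?C. q ^ up_edges E S (V - S) * x k ^ card S * ?w (V - S) \<kappa>)"
  proof (rule sum.reindex_bij_witness[where
        i = "\<lambda>(S, \<kappa>) v. if v \<in> S then k else \<kappa> v" and
        j = "\<lambda>\<kappa>. ({v\<in>V. \<kappa> v = k}, restrict \<kappa> (V - {v\<in>V. \<kappa> v = k}))"])
    fix \<kappa> assume K: "\<kappa> \<in> colorings E V {k..M}"
    define S where "S = {v\<in>V. \<kappa> v = k}"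
    define \<mu> where "\<mu> = restrict \<kappa> (V - S)"
    have S: "S \<subseteq> V" by (auto simp: S_def)
    have \<kappa>: "\<kappa> \<in> V \<rightarrow>\<^sub>E {k..M}"
      "\<And>a b. a \<in> V \<Longrightarrow> b \<in> V \<Longrightarrow> a < b \<Longrightarrow> E a b \<Longrightarrow> \<kappa> a \<noteq> \<kappa> b"
      using K by (auto simp: colorings_def)
    have gt: "Suc k \<le> \<kappa> v" "\<kappa> v \<le> M" if "v \<in> V - S" for v
      using that PiE_mem[OF \<kappa>(1), of v] by (auto simp: S_def)
    show "(case ({v\<in>V. \<kappa> v = k}, restrict \<kappa> (V - {v\<in>V. \<kappa> v = k})) of
        (S, \<kappa>) \<Rightarrow> \<lambda>v. if v \<in> S then k else \<kappa> v) = \<kappa>"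
      unfolding prod.case
    proof
      fix v
      show "(if v \<in> {v\<in>V. \<kappa> v = k} then k else restrict \<kappa> (V - {v\<in>V. \<kappa> v = k}) v) = \<kappa> v"
        using PiE_arb[OF \<kappa>(1), of v] by (cases "v \<in> V") auto
    qed
    have ind: "independent E S"
      unfolding independent_def S_def using \<kappa>(2) by fastforce
    have mem: "(S, \<mu>) \<in> Sigma ?I ?C"
      using S ind gt \<kappa>(2) by (auto simp: \<mu>_def colorings_def)
    then show "({v\<in>V. \<kappa> v = k}, restrict \<kappa> (V - {v\<in>V. \<kappa> v = k})) \<in> Sigma ?I ?C"
      unfolding \<mu>_def S_def .
    have "ascents E V \<kappa> = up_edges E S (V - S) + ascents E (V - S) \<kappa>"
      using Suc.prems(1) S gt by (intro ascents_lowest_class[where k = k]) (auto simp: S_def Suc_le_eq)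
    also have "ascents E (V - S) \<kappa> = ascents E (V - S) \<mu>"
      unfolding ascents_def \<mu>_def by (intro sum.cong refl) auto
    finally have asc: "ascents E V \<kappa> = up_edges E S (V - S) + ascents E (V - S) \<mu>" .
    have "(\<Prod>v\<in>V. x (\<kappa> v)) = (\<Prod>v\<in>V - S. x (\<kappa> v)) * (\<Prod>v\<in>S. x (\<kappa> v))"
      using S Suc.prems(1) by (rule prod.subset_diff)
    also have "(\<Prod>v\<in>S. x (\<kappa> v)) = x k ^ card S"
      by (simp add: S_def)
    also have "(\<Prod>v\<in>V - S. x (\<kappa> v)) = (\<Prod>v\<in>V - S. x (\<mu> v))"
      by (simp add: \<mu>_def)
    finally have "q ^ up_edges E S (V - S) * x k ^ card S * ?w (V - S) \<mu> = ?w V \<kappa>"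
      by (simp add: asc power_add ac_simps)
    then show "(case ({v\<in>V. \<kappa> v = k}, restrict \<kappa> (V - {v\<in>V. \<kappa> v = k})) of
        (S, \<kappa>) \<Rightarrow> q ^ up_edges E S (V - S) * x k ^ card S * ?w (V - S) \<kappa>) = ?w V \<kappa>"
      unfolding \<mu>_def S_def by simp
  next
    fix p assume "p \<in> Sigma ?I ?C"
    then obtain S \<mu> where p: "p = (S, \<mu>)" and S: "S \<subseteq> V" "independent E S"
      and \<mu>: "\<mu> \<in> (V - S) \<rightarrow>\<^sub>E {Suc k..M}"
        "\<And>a b. a \<in> V - S \<Longrightarrow> b \<in> V - S \<Longrightarrow> a < b \<Longrightarrow> E a b \<Longrightarrow> \<mu> a \<noteq> \<mu> b"
      by (auto simp: colorings_def)
    define \<kappa> where "\<kappa> = (\<lambda>v. if v \<in> S then k else \<mu> v)"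
    have gt: "Suc k \<le> \<mu> v \<and> \<mu> v \<le> M" if "v \<in> V" "v \<notin> S" for v
      using that PiE_mem[OF \<mu>(1), of v] by auto
    have cls: "{v\<in>V. \<kappa> v = k} = S"
      using S gt by (force simp: \<kappa>_def)
    have "restrict \<kappa> (V - S) = \<mu>"
    proof
      fix v
      show "restrict \<kappa> (V - S) v = \<mu> v"
        using PiE_arb[OF \<mu>(1), of v] by (cases "v \<in> V - S") (auto simp: \<kappa>_def)
    qed
    then show "({v\<in>V. (case p of (S, \<kappa>) \<Rightarrow> \<lambda>v. if v \<in> S then k else \<kappa> v) v = k},
         restrict (case p of (S, \<kappa>) \<Rightarrow> \<lambda>v. if v \<in> S then k else \<kappa> v)
           (V - {v\<in>V. (case p of (S, \<kappa>) \<Rightarrow> \<lambda>v. if v \<in> S then k else \<kappa> v) v = k})) = p"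
      using cls unfolding p prod.case \<kappa>_def by simp
    have "\<kappa> v \<in> {k..M}" if "v \<in> V" for v
      using gt[of v] kM that by (auto simp: \<kappa>_def)
    moreover have "\<kappa> v = undefined" if "v \<notin> V" for v
      using that S PiE_arb[OF \<mu>(1), of v] by (auto simp: \<kappa>_def)
    moreover have "\<kappa> a \<noteq> \<kappa> b" if "a \<in> V" "b \<in> V" "a < b" "E a b" for a b
      using that \<mu>(2)[of a b] S(2) gt[of a] gt[of b] unfolding \<kappa>_def independent_def by auto
    ultimately have "\<kappa> \<in> colorings E V {k..M}"
      by (auto simp: colorings_def PiE_def extensional_def)
    then show "(case p of (S, \<kappa>) \<Rightarrow> \<lambda>v. if v \<in> S then k else \<kappa> v) \<in> colorings E V {k..M}"
      unfolding p prod.case \<kappa>_def .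
  qed
  also have "\<dots> = (\<Sum>S\<in>?I. \<Sum>\<kappa>\<in>?C S. q ^ up_edges E S (V - S) * x k ^ card S * ?w (V - S) \<kappa>)"
    using Suc.prems(1) by (intro sum.Sigma[symmetric]) (auto intro: finite_colorings)
  also have "\<dots> = (\<Sum>S\<in>?I. q ^ up_edges E S (V - S) * x k ^ card S
      * class_sum E q (map x [Suc k..<Suc M]) (V - S))"
    by (simp only: sum_distrib_left[symmetric] IH)
  also have "\<dots> = class_sum E q (map x [k..<Suc M]) V"
    using kM by (simp add: upt_conv_Cons del: upt_Suc)
  finally show ?case .
qed

section \<open>Graphs of partitions\<close>

text \<open>
  Adjacency of \<open>a < b\<close> in the graph of a partition, where row \<open>i\<close> is the vertex \<open>N + 1 - i\<close>.
  If \<open>b\<close> is a column vertex, then \<open>N + 1 - b\<close> exceeds the number of rows and the pair is adjacent.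
\<close>

definition board_edge :: "nat \<Rightarrow> nat list \<Rightarrow> nat \<Rightarrow> nat \<Rightarrow> bool" where
  "board_edge N la a b \<longleftrightarrow> (N + 1 - b, a) \<notin> cells la"

lemma cells_bounds:
  assumes "partition_in_board n m la" "(i, j) \<in> cells la"
  shows "1 \<le> i" "i \<le> n" "1 \<le> j" "j \<le> m"
proof -
  have "i - 1 < length la" "j \<le> la ! (i - 1)"
    using assms(2) by (auto simp: cells_def)
  then show "j \<le> m"
    using assms(1) unfolding partition_in_board_def by (meson nth_mem order_trans)
  show "1 \<le> i" "i \<le> n" "1 \<le> j"
    using assms by (auto simp: cells_def partition_in_board_def)
qed

lemma cells_mono:
  assumes "partition_in_board n m la" "(i, j) \<in> cells la" "1 \<le> i'" "i' \<le> i" "1 \<le> j'" "j' \<le> j"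
  shows "(i', j') \<in> cells la"
proof -
  have "la ! (i - 1) \<le> la ! (i' - 1)"
  proof (cases "i' = i")
    case False
    then have "i' - 1 < i - 1" "i - 1 < length la"
      using assms by (auto simp: cells_def)
    then show ?thesis
      using assms(1) unfolding partition_in_board_def by (simp add: sorted_wrt_iff_nth_less)
  qed simp
  then show ?thesis
    using assms by (auto simp: cells_def)
qed

lemma finite_cells: "finite (cells la)"
proof -
  have "cells la = Sigma {1..length la} (\<lambda>i. {1..la ! (i - 1)})"
    by (auto simp: cells_def)
  then show ?thesis by simp
qed

lemma graph_edges_iff:
  assumes "partition_in_board n m la" "N = m + n" "a < b"
  shows "{a, b} \<in> graph_edges N la \<longleftrightarrow> a \<in> {1..N} \<and> b \<in> {1..N} \<and> board_edge N la a b"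
proof -
  have 1: "{a, b} \<in> {{a, b} | a b. 1 \<le> a \<and> a < b \<and> b \<le> N} \<longleftrightarrow> a \<in> {1..N} \<and> b \<in> {1..N}"
    using assms(3) by (auto simp: doubleton_eq_iff)
  have 2: "{a, b} \<in> {{a, N + 1 - i} | i a. (i, a) \<in> cells la} \<longleftrightarrow> (N + 1 - b, a) \<in> cells la"
    if "b \<in> {1..N}"
  proof
    assume "{a, b} \<in> {{a, N + 1 - i} | i a. (i, a) \<in> cells la}"
    then obtain i c where ic: "(i, c) \<in> cells la" "{a, b} = {c, N + 1 - i}"
      by blast
    have "c < N + 1 - i" "N + 1 - (N + 1 - i) = i"
      using cells_bounds[OF assms(1) ic(1)] assms(2) by auto
    then show "(N + 1 - b, a) \<in> cells la"
      using ic assms(3) by (auto simp: doubleton_eq_iff)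
  next
    assume "(N + 1 - b, a) \<in> cells la"
    moreover have "b = N + 1 - (N + 1 - b)" using that by auto
    ultimately show "{a, b} \<in> {{a, N + 1 - i} | i a. (i, a) \<in> cells la}"
      unfolding mem_Collect_eq by (intro exI[of _ "N + 1 - b"] exI[of _ a]) simp
  qed
  show ?thesis
    using 1 2 unfolding graph_edges_def board_edge_def by blast
qed

lemma chrom_eq_class_sum:
  assumes "partition_in_board n m la" "N = m + n"
  shows "chrom N la M = class_sum (board_edge N la) qvar (map xvar [1..<Suc M]) {1..N}"
proof -
  let ?E = "board_edge N la"
  have loop: "{a, a} \<notin> graph_edges N la" for a
    by (auto simp: graph_edges_def doubleton_eq_iff)
  have "proper_colorings N la M = colorings ?E {1..N} {1..M}"
  proof -
    have "(\<forall>a b. {a, b} \<in> graph_edges N la \<longrightarrow> \<kappa> a \<noteq> \<kappa> b)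
        \<longleftrightarrow> (\<forall>a\<in>{1..N}. \<forall>b\<in>{1..N}. a < b \<and> ?E a b \<longrightarrow> \<kappa> a \<noteq> \<kappa> b)" for \<kappa> :: "nat \<Rightarrow> nat"
    proof
      assume "\<forall>a b. {a, b} \<in> graph_edges N la \<longrightarrow> \<kappa> a \<noteq> \<kappa> b"
      then show "\<forall>a\<in>{1..N}. \<forall>b\<in>{1..N}. a < b \<and> ?E a b \<longrightarrow> \<kappa> a \<noteq> \<kappa> b"
        using graph_edges_iff[OF assms] by blast
    next
      assume *: "\<forall>a\<in>{1..N}. \<forall>b\<in>{1..N}. a < b \<and> ?E a b \<longrightarrow> \<kappa> a \<noteq> \<kappa> b"
      show "\<forall>a b. {a, b} \<in> graph_edges N la \<longrightarrow> \<kappa> a \<noteq> \<kappa> b"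
      proof (intro allI impI)
        fix a b assume e: "{a, b} \<in> graph_edges N la"
        consider "a < b" | "a = b" | "b < a" by linarith
        then show "\<kappa> a \<noteq> \<kappa> b"
        proof cases
          case 1
          then show ?thesis using * e graph_edges_iff[OF assms, of a b] by blast
        next
          case 2
          then show ?thesis using e loop by blast
        next
          case 3
          moreover have "{b, a} \<in> graph_edges N la" using e by (simp add: insert_commute)
          ultimately have "\<kappa> b \<noteq> \<kappa> a"
            using * graph_edges_iff[OF assms, of b a] by blast
          then show ?thesis by simp
        qed
      qed
    qed
    then show ?thesis
      unfolding proper_colorings_def colorings_def by blast
  qed
  moreover have "asc N la \<kappa> = ascents ?E {1..N} \<kappa>" for \<kappa>
  proof -
    have "ascents ?E {1..N} \<kappa>
        = (\<Sum>(a, b)\<in>{1..N} \<times> {1..N}. of_bool (a < b \<and> ?E a b \<and> \<kappa> a < \<kappa> b))"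
      unfolding ascents_def by (rule sum.cartesian_product)
    also have "\<dots> = (\<Sum>p\<in>{1..N} \<times> {1..N}.
        of_bool (fst p < snd p \<and> ?E (fst p) (snd p) \<and> \<kappa> (fst p) < \<kappa> (snd p)))"
      by (simp only: case_prod_unfold)
    also have "\<dots> = card ({1..N} \<times> {1..N}
        \<inter> {p. fst p < snd p \<and> ?E (fst p) (snd p) \<and> \<kappa> (fst p) < \<kappa> (snd p)})"
      by (simp add: sum_of_bool_eq)
    also have "{1..N} \<times> {1..N} \<inter> {p. fst p < snd p \<and> ?E (fst p) (snd p) \<and> \<kappa> (fst p) < \<kappa> (snd p)}
        = {(a, b). {a, b} \<in> graph_edges N la \<and> a < b \<and> \<kappa> a < \<kappa> b}"
      using graph_edges_iff[OF assms] by auto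
    finally show ?thesis by (simp add: asc_def)
  qed
  ultimately show ?thesis
    unfolding chrom_def using colorings_eq_class_sum[of "{1..N}" 1 M qvar ?E xvar] by simp
qed

lemma co_bipartite_interval_board_edge:
  assumes "partition_in_board n m la" "N = m + n"
  shows "co_bipartite_interval (board_edge N la) {1..N}"
  unfolding co_bipartite_interval_def board_edge_def
proof (intro ballI impI conjI)
  fix a b c assume *: "a \<in> {1..N}" "b \<in> {1..N}" "c \<in> {1..N}" "a < b" "b < c"
  show "(N + 1 - b, a) \<notin> cells la \<or> (N + 1 - c, b) \<notin> cells la"
  proof (rule ccontr)
    assume "\<not> ?thesis"
    then have "N + 1 - b \<le> n" "b \<le> m"
      using cells_bounds[OF assms(1)] by blast+
    then show False using assms(2) by linarith
  qed
  assume ac: "(N + 1 - c, a) \<notin> cells la"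
  have "1 \<le> N + 1 - c" "N + 1 - c \<le> N + 1 - b" using * by auto
  note rows = this
  show "(N + 1 - b, a) \<notin> cells la"
    using ac cells_mono[OF assms(1), of "N + 1 - b" a "N + 1 - c" a] * rows by auto
  show "(N + 1 - c, b) \<notin> cells la"
    using ac cells_mono[OF assms(1), of "N + 1 - c" b "N + 1 - c" a] * rows by auto
qed

section \<open>Removing rows and columns\<close>

lemma partition_remove_column:
  assumes "partition_in_board n m la" "1 \<le> j" "j \<le> m"
  shows "partition_in_board n (m - 1) (remove_column j la)"
proof -
  have "sorted_wrt (\<lambda>p r. (if j \<le> p then p - 1 else p) \<ge> (if j \<le> r then r - 1 else r)) la"
    using assms(1) unfolding partition_in_board_def
    by (auto elim!: sorted_wrt_mono_rel[rotated])
  then show ?thesis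
    using assms by (auto simp: partition_in_board_def remove_column_def sorted_wrt_map)
qed

lemma cells_remove_column:
  assumes "1 \<le> c" "1 \<le> j"
  shows "(i, c) \<in> cells (remove_column j la) \<longleftrightarrow> (i, if c < j then c else c + 1) \<in> cells la"
  using assms by (auto simp: cells_def remove_column_def split: if_splits)

lemma partition_remove_row:
  assumes "partition_in_board n m la" "1 \<le> r" "r \<le> n"
  shows "partition_in_board (n - 1) m (remove_row r la)"
proof -
  have la: "la = take (r - 1) la @ la ! (r - 1) # drop r la"
    using assms id_take_nth_drop[of "r - 1" la] by (simp add: partition_in_board_def)
  have "sorted_wrt (\<ge>) la"
    using assms(1) by (simp add: partition_in_board_def)
  then have "sorted_wrt (\<ge>) (take (r - 1) la @ la ! (r - 1) # drop r la)"
    by (rule subst[OF la, where P = "sorted_wrt (\<ge>)"])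
  then have "sorted_wrt (\<ge>) (remove_row r la)"
    unfolding remove_row_def sorted_wrt_append sorted_wrt.simps(2) list.set(2) by blast
  moreover have "set (remove_row r la) \<subseteq> set la"
    unfolding remove_row_def by (auto dest: in_set_takeD in_set_dropD)
  ultimately show ?thesis
    using assms by (auto simp: partition_in_board_def remove_row_def)
qed

lemma cells_remove_row:
  assumes "1 \<le> i" "1 \<le> r" "r \<le> length la"
  shows "(i, c) \<in> cells (remove_row r la) \<longleftrightarrow> (if i < r then i else i + 1, c) \<in> cells la"
proof -
  have "length (remove_row r la) = length la - 1"
    using assms by (auto simp: remove_row_def)
  moreover have "remove_row r la ! (i - 1) = la ! ((if i < r then i else i + 1) - 1)"
    if "i \<le> length la - 1"
    using assms that by (auto simp: remove_row_def nth_append)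
  ultimately show ?thesis
    using assms by (auto simp: cells_def)
qed

text \<open>
  The increasing relabelling of the vertices other than \<open>v\<close> that fills the place of \<open>v\<close>.
\<close>

definition close_gap :: "nat \<Rightarrow> nat \<Rightarrow> nat" where
  "close_gap v u = (if u < v then u else u - 1)"

lemma strict_mono_on_close_gap: "strict_mono_on (U - {v}) (close_gap v)"
  by (auto simp: strict_mono_on_def close_gap_def)

lemma close_gap_image:
  assumes "v \<in> {1..N}"
  shows "close_gap v ` ({1..N} - {v}) = {1..N - 1}"
proof
  show "close_gap v ` ({1..N} - {v}) \<subseteq> {1..N - 1}"
    using assms by (auto simp: close_gap_def)
  show "{1..N - 1} \<subseteq> close_gap v ` ({1..N} - {v})"
  proof
    fix u assume "u \<in> {1..N - 1}"
    then show "u \<in> close_gap v ` ({1..N} - {v})"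
      using assms
      by (intro image_eqI[of _ _ "if u < v then u else u + 1"]) (auto simp: close_gap_def)
  qed
qed

lemma class_sum_remove_column:
  assumes la: "partition_in_board n m la" and N: "N = m + n"
    and j: "1 \<le> j" "j \<le> m" and U: "U \<subseteq> {1..N} - {j}"
  shows "class_sum (board_edge N la) q ys U
       = class_sum (board_edge (N - 1) (remove_column j la)) q ys (close_gap j ` U)"
proof (rule class_sum_image[symmetric])
  show "strict_mono_on U (close_gap j)"
    using strict_mono_on_close_gap[of "{1..N}" j] U unfolding strict_mono_on_def by blast
  fix a b assume "a \<in> U" "b \<in> U" "a < b"
  then have ab: "1 \<le> a" "a \<noteq> j" "b \<noteq> j" "a < b" "b \<le> N" using U by auto
  have col: "(i, close_gap j a) \<in> cells (remove_column j la) \<longleftrightarrow> (i, a) \<in> cells la" for i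
    using ab j by (subst cells_remove_column) (auto simp: close_gap_def)
  show "board_edge (N - 1) (remove_column j la) (close_gap j a) (close_gap j b) = board_edge N la a b"
  proof (cases "b < j")
    case True
    then have "n < N - b" "n < N + 1 - b" using j N by auto
    then have "(N - b, a) \<notin> cells la" "(N + 1 - b, a) \<notin> cells la"
      using cells_bounds(2)[OF la] by (meson not_le)+
    moreover have "N - 1 + 1 - close_gap j b = N - b"
      using True j N by (auto simp: close_gap_def)
    ultimately show ?thesis by (simp add: board_edge_def col del: diff_diff_left)
  next
    case False
    then have "N - 1 + 1 - close_gap j b = N + 1 - b"
      using ab by (auto simp: close_gap_def)
    then show ?thesis unfolding board_edge_def by (simp only: col)
  qed
qed

lemma class_sum_remove_row:
  assumes la: "partition_in_board n m la" and N: "N = m + n"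
    and r: "1 \<le> r" "r \<le> n" and U: "U \<subseteq> {1..N} - {N + 1 - r}"
  shows "class_sum (board_edge N la) q ys U
       = class_sum (board_edge (N - 1) (remove_row r la)) q ys (close_gap (N + 1 - r) ` U)"
proof (rule class_sum_image[symmetric])
  let ?v = "N + 1 - r"
  show "strict_mono_on U (close_gap ?v)"
    using strict_mono_on_close_gap[of "{1..N}" ?v] U unfolding strict_mono_on_def by blast
  fix a b assume "a \<in> U" "b \<in> U" "a < b"
  then have ab: "1 \<le> a" "a \<noteq> ?v" "b \<noteq> ?v" "a < b" "b \<le> N" using U by auto
  have len: "r \<le> length la" using la r by (simp add: partition_in_board_def)
  define i where "i = N - 1 + 1 - close_gap ?v b"
  have i: "1 \<le> i" "(if i < r then i else i + 1) = N + 1 - b"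
  proof -
    have "1 \<le> i \<and> (if i < r then i else i + 1) = N + 1 - b"
    proof (cases "b < ?v")
      case True
      then have "i = N - b" "r \<le> N - b"
        using ab(1,4) by (simp_all add: i_def close_gap_def)
      then show ?thesis using r(1) by simp
    next
      case False
      then have "?v < b" using ab(3) by simp
      then have "i = N + 1 - b" "N + 1 - b < r"
        using ab(5) by (simp_all add: i_def close_gap_def)
      then show ?thesis using ab(5) by simp
    qed
    then show "1 \<le> i" "(if i < r then i else i + 1) = N + 1 - b" by simp_all
  qed
  have row: "(i, c) \<in> cells (remove_row r la) \<longleftrightarrow> (N + 1 - b, c) \<in> cells la" for c
    using cells_remove_row[OF i(1) r(1) len, of c] i(2) by simp
  show "board_edge (N - 1) (remove_row r la) (close_gap ?v a) (close_gap ?v b) = board_edge N la a b"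
  proof (cases "a < ?v")
    case True
    then show ?thesis
      unfolding board_edge_def i_def[symmetric] row by (simp add: close_gap_def)
  next
    case False
    then have "m < a" "m < close_gap ?v a"
      using ab r N by (auto simp: close_gap_def)
    then show ?thesis
      unfolding board_edge_def i_def[symmetric] row using cells_bounds(4)[OF la] by (meson not_le)
  qed
qed

section \<open>Independent sets and the edges leaving them\<close>

text \<open>
  All larger vertices are adjacent to \<open>i\<close> except the rows that have a cell in column \<open>i\<close>. For a row
  vertex \<open>i > m\<close> there are none, and \<open>conj_part la i\<close> is \<open>0\<close>.
\<close>

lemma up_edges_vertex:
  assumes la: "partition_in_board n m la" and N: "N = m + n" and i: "i \<in> {1..N}"
  shows "up_edges (board_edge N la) {i} ({1..N} - {i}) = N - i - conj_part la i"
proof -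
  let ?R = "{r. (r, i) \<in> cells la}"
  have R: "1 \<le> r" "r \<le> n" "i \<le> m" if "r \<in> ?R" for r
    using that cells_bounds[OF la, of r i] by auto
  have finR: "finite ?R"
    using R by (auto intro: finite_subset[of _ "{1..n}"])
  have inj: "inj_on (\<lambda>r. N + 1 - r) ?R"
    using R N by (auto intro!: inj_onI) (metis R(2) add_leD2 diff_diff_cancel le_SucI trans_le_add2)
  have sub: "(\<lambda>r. N + 1 - r) ` ?R \<subseteq> {i<..N}"
    using R N by fastforce
  have "up_edges (board_edge N la) {i} ({1..N} - {i})
      = card (({1..N} - {i}) \<inter> {b. i < b \<and> board_edge N la i b})"
    unfolding up_edges_def by (simp add: sum_of_bool_eq)
  also have "({1..N} - {i}) \<inter> {b. i < b \<and> board_edge N la i b} = {i<..N} - (\<lambda>r. N + 1 - r) ` ?R"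
  proof -
    have "(N + 1 - b, i) \<in> cells la \<longleftrightarrow> b \<in> (\<lambda>r. N + 1 - r) ` ?R" if "b \<in> {i<..N}" for b
    proof
      assume "(N + 1 - b, i) \<in> cells la"
      then show "b \<in> (\<lambda>r. N + 1 - r) ` ?R"
        using that by (intro image_eqI[of _ _ "N + 1 - b"]) auto
    next
      assume "b \<in> (\<lambda>r. N + 1 - r) ` ?R"
      then obtain r where r: "r \<in> ?R" "b = N + 1 - r" by blast
      then have "N + 1 - b = r" using R[OF r(1)] N by auto
      then show "(N + 1 - b, i) \<in> cells la" using r by simp
    qed
    then show ?thesis
      using i by (auto simp: board_edge_def)
  qed
  also have "card \<dots> = N - i - conj_part la i"
    using sub finR inj by (simp add: card_Diff_subset card_image conj_part_def)
  finally show ?thesis .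
qed

lemma up_edges_cell:
  assumes la: "partition_in_board n m la" and N: "N = m + n" and ij: "(i, j) \<in> cells la"
  shows "up_edges (board_edge N la) {j, N + 1 - i} ({1..N} - {j, N + 1 - i})
       = i - 1 + (N - j - conj_part la j)"
proof -
  let ?E = "board_edge N la" and ?v = "N + 1 - i"
  let ?R = "{1..N} - {j, ?v}"
  have b: "1 \<le> i" "i \<le> n" "1 \<le> j" "j \<le> m"
    using cells_bounds[OF la ij] by auto
  then have v: "j < ?v" "?v \<in> {1..N}" "j \<in> {1..N}" "N + 1 - ?v = i" "m < ?v"
    using N by auto
  \<comment> \<open>The vertex of row \<open>i\<close> lies beyond the last column.\<close>
  have "conj_part la ?v = card ({} :: nat set)"
    unfolding conj_part_def using v(5) cells_bounds(4)[OF la]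
    by (intro arg_cong[of _ _ card]) (auto simp: not_le[symmetric])
  then have cv: "conj_part la ?v = 0" by simp
  have "{1..N} - {j} = {?v} \<union> ?R" "{1..N} - {?v} = {j} \<union> ?R"
    using v by auto
  moreover have "up_edges ?E {j} ({?v} \<union> ?R) = up_edges ?E {j} {?v} + up_edges ?E {j} ?R"
    "up_edges ?E {?v} ({j} \<union> ?R) = up_edges ?E {?v} {j} + up_edges ?E {?v} ?R"
    by (rule up_edges_Un_right; simp)+
  ultimately have "up_edges ?E {j} ({1..N} - {j}) = up_edges ?E {j} {?v} + up_edges ?E {j} ?R"
    "up_edges ?E {?v} ({1..N} - {?v}) = up_edges ?E {?v} {j} + up_edges ?E {?v} ?R"
    by (simp_all only:)
  moreover have "up_edges ?E {j} {?v} = 0" "up_edges ?E {?v} {j} = 0"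
    using v ij unfolding up_edges_def board_edge_def by auto
  moreover have "N - ?v - conj_part la ?v = i - 1"
    using cv v(4) by simp
  ultimately have "up_edges ?E {j} ?R = N - j - conj_part la j" "up_edges ?E {?v} ?R = i - 1"
    using up_edges_vertex[OF la N v(3)] up_edges_vertex[OF la N v(2)] by linarith+
  moreover have "up_edges ?E ({j} \<union> {?v}) ?R = up_edges ?E {j} ?R + up_edges ?E {?v} ?R"
    using v by (intro up_edges_Un_left) auto
  ultimately have "up_edges ?E ({j} \<union> {?v}) ?R = i - 1 + (N - j - conj_part la j)"
    by linarith
  moreover have "{j} \<union> {?v} = {j, ?v}" by auto
  ultimately show ?thesis by (simp only:)
qed

lemma independent_sets:
  assumes la: "partition_in_board n m la" and N: "N = m + n"
  shows "{S. S \<subseteq> {1..N} \<and> independent (board_edge N la) S}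
       = insert {} ((\<lambda>i. {i}) ` {1..N} \<union> (\<lambda>(i, j). {j, N + 1 - i}) ` cells la)" (is "?L = ?R")
proof
  show "?L \<subseteq> ?R"
  proof
    fix S assume "S \<in> ?L"
    then have S: "S \<subseteq> {1..N}" "independent (board_edge N la) S" by auto
    then have "finite S" using finite_subset by blast
    then have "card S \<le> 2"
      using card_independent_le_2[OF co_bipartite_interval_board_edge[OF la N]] S by blast
    then consider "card S = 0" | "card S = 1" | "card S = 2" by linarith
    then show "S \<in> ?R"
    proof cases
      case 1
      then show ?thesis using \<open>finite S\<close> by simp
    next
      case 2
      then show ?thesis using S by (auto simp: card_1_singleton_iff)
    next
      case 3
      then obtain a b where ab: "S = {a, b}" "a < b"
        by (metis card_2_iff insert_commute linorder_less_linear)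
      then have "(N + 1 - b, a) \<in> cells la" "S = {a, N + 1 - (N + 1 - b)}"
        using S by (auto simp: independent_def board_edge_def)
      then show ?thesis by (intro insertI2 UnI2) (auto intro!: image_eqI[of _ _ "(N + 1 - b, a)"])
    qed
  qed
  have "{j, N + 1 - i} \<in> ?L" if "(i, j) \<in> cells la" for i j
  proof -
    have "j < N + 1 - i" "N + 1 - i \<in> {1..N}" "j \<in> {1..N}" "N + 1 - (N + 1 - i) = i"
      using cells_bounds[OF la that] N by auto
    then show ?thesis
      using that by (auto simp: independent_def board_edge_def)
  qed
  then show "?R \<subseteq> ?L"
    by (auto simp: independent_def)
qed

section \<open>Removing the class of one color\<close>

lemma chrom_remove_line:
  assumes la: "partition_in_board n m la" and i: "i \<in> {1..m + n}"
  shows "class_sum (board_edge (m + n) la) qvar (map xvar [1..<Suc M]) ({1..m + n} - {i})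
       = chrom (m + n - 1) (remove_line n m la i) M"
proof (cases "i \<le> m")
  case True
  then have "partition_in_board n (m - 1) (remove_column i la)"
    using la i by (intro partition_remove_column) auto
  then have "chrom (m + n - 1) (remove_column i la) M
      = class_sum (board_edge (m + n - 1) (remove_column i la)) qvar (map xvar [1..<Suc M]) {1..m + n - 1}"
    using True i by (intro chrom_eq_class_sum[of n "m - 1"]) auto
  then show ?thesis
    using class_sum_remove_column[OF la refl _ True order_refl] i True close_gap_image[OF i]
    by (simp add: remove_line_def del: upt_Suc)
next
  case False
  define r where "r = m + n - i + 1"
  have r: "1 \<le> r" "r \<le> n" "m + n + 1 - r = i"
    using False i by (auto simp: r_def)
  have "partition_in_board (n - 1) m (remove_row r la)"
    using la r by (intro partition_remove_row) auto
  then have "chrom (m + n - 1) (remove_row r la) M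
      = class_sum (board_edge (m + n - 1) (remove_row r la)) qvar (map xvar [1..<Suc M]) {1..m + n - 1}"
    using r by (intro chrom_eq_class_sum[of "n - 1" m]) auto
  then show ?thesis
    using class_sum_remove_row[OF la refl r(1,2) order_refl] False close_gap_image[OF i] r(3)
    by (simp add: remove_line_def r_def del: upt_Suc)
qed

lemma chrom_remove_cell_lines:
  assumes la: "partition_in_board n m la" and ij: "(i, j) \<in> cells la"
  shows "class_sum (board_edge (m + n) la) qvar (map xvar [1..<Suc M])
           ({1..m + n} - {j, m + n + 1 - i})
       = chrom (m + n - 2) (remove_cell_lines la (i, j)) M"
proof -
  let ?N = "m + n" and ?mu = "remove_column j la"
  let ?v = "?N + 1 - i"
  let ?c = "class_sum (board_edge ?N la) qvar (map xvar [1..<Suc M]) ({1..?N} - {j, ?v})"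
  have b: "1 \<le> i" "i \<le> n" "1 \<le> j" "j \<le> m"
    using cells_bounds[OF la ij] by auto
  have mu: "partition_in_board n (m - 1) ?mu"
    using la b by (intro partition_remove_column)
  have nu: "partition_in_board (n - 1) (m - 1) (remove_row i ?mu)"
    using mu b by (intro partition_remove_row)
  \<comment> \<open>Once column \<open>j\<close> is removed, row \<open>i\<close> is the vertex \<open>m + n - i\<close>.\<close>
  have gap: "close_gap j ` ({1..?N} - {j, ?v}) = {1..?N - 1} - {?N - 1 + 1 - i}"
  proof -
    have "inj_on (close_gap j) ({1..?N} - {j})"
      by (rule strict_mono_on_imp_inj_on[OF strict_mono_on_close_gap])
    then have "close_gap j ` ({1..?N} - {j} - {?v})
        = close_gap j ` ({1..?N} - {j}) - close_gap j ` {?v}"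
      using b by (intro inj_on_image_set_diff) auto
    moreover have "close_gap j ?v = ?N - 1 + 1 - i"
      using b by (auto simp: close_gap_def)
    moreover have "{1..?N} - {j} - {?v} = {1..?N} - {j, ?v}" by auto
    moreover have "close_gap j ` ({1..?N} - {j}) = {1..?N - 1}"
      using b by (intro close_gap_image) simp
    ultimately show ?thesis
      by (simp only: image_insert image_empty)
  qed
  have "?c = class_sum (board_edge (?N - 1) ?mu) qvar (map xvar [1..<Suc M])
      ({1..?N - 1} - {?N - 1 + 1 - i})"
    using b unfolding gap[symmetric] by (intro class_sum_remove_column[OF la refl]) auto
  also have "\<dots> = class_sum (board_edge (?N - 1 - 1) (remove_row i ?mu)) qvar (map xvar [1..<Suc M])
      (close_gap (?N - 1 + 1 - i) ` ({1..?N - 1} - {?N - 1 + 1 - i}))"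
    using b by (intro class_sum_remove_row[OF mu]) auto
  also have "\<dots> = class_sum (board_edge (?N - 1 - 1) (remove_row i ?mu)) qvar (map xvar [1..<Suc M])
      {1..?N - 1 - 1}"
    using b by (subst close_gap_image) auto
  also have "\<dots> = chrom (?N - 1 - 1) (remove_row i ?mu) M"
    using b by (intro chrom_eq_class_sum[OF nu, symmetric]) auto
  also have "?N - 1 - 1 = ?N - 2" by simp
  finally show ?thesis
    by (simp add: remove_cell_lines_def)
qed

theorem lemma3p2:
  fixes m n M :: nat and la :: "nat list"
  assumes "n \<le> m" and "1 \<le> M" and "partition_in_board n m la"
  shows "chrom (m + n) la M =
           chrom (m + n) la (M - 1)
         + xvar M * (\<Sum>i\<in>{1..m + n}. qvar ^ (m + n - i - conj_part la i)
                       * chrom (m + n - 1) (remove_line n m la i) (M - 1))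
         + (xvar M)\<^sup>2 * (\<Sum>(i, j)\<in>cells la. qvar ^ (i - 1 + (m + n - j - conj_part la j))
                       * chrom (m + n - 2) (remove_cell_lines la (i, j)) (M - 1))"
proof -
  note la = assms(3)
  let ?N = "m + n"
  let ?V = "{1..?N}" and ?E = "board_edge ?N la" and ?ys = "map xvar [1..<Suc (M - 1)]"
  define F where "F S = qvar ^ up_edges ?E S (?V - S) * xvar M ^ card S
    * class_sum ?E qvar ?ys (?V - S)" for S
  let ?pair = "\<lambda>(i, j). {j, ?N + 1 - i}"
  have ys: "map xvar [1..<Suc M] = ?ys @ [xvar M]"
    using assms(2) by (cases M) auto
  have two: "j < ?N + 1 - i" "?N + 1 - (?N + 1 - i) = i" if "(i, j) \<in> cells la" for i j
    using cells_bounds[OF la that] by auto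
  have inj: "inj_on ?pair (cells la)"
  proof (intro inj_onI, clarify)
    fix i j i' j' assume *: "(i, j) \<in> cells la" "(i', j') \<in> cells la"
      "{j, ?N + 1 - i} = {j', ?N + 1 - i'}"
    then show "i = i' \<and> j = j'"
      using two[OF *(1)] two[OF *(2)] by (auto simp: doubleton_eq_iff)
  qed
  have disj: "{} \<notin> (\<lambda>i. {i}) ` ?V \<union> ?pair ` cells la" "(\<lambda>i. {i}) ` ?V \<inter> ?pair ` cells la = {}"
    using two(1) by (auto simp: doubleton_eq_iff)
  have "chrom ?N la M = class_sum ?E qvar (?ys @ [xvar M]) ?V"
    using chrom_eq_class_sum[OF la refl] ys by simp
  \<comment> \<open>By symmetry \<open>x_M\<close> may be taken as the weight of the lowest color.\<close>
  also have "\<dots> = class_sum ?E qvar (xvar M # ?ys) ?V"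
    by (intro class_sum_rotate co_bipartite_interval_board_edge[OF la]) auto
  also have "\<dots> = sum F {S. S \<subseteq> ?V \<and> independent ?E S}"
    by (simp add: F_def)
  also have "\<dots> = F {} + (sum F ((\<lambda>i. {i}) ` ?V) + sum F (?pair ` cells la))"
    unfolding independent_sets[OF la refl] using disj finite_cells
    by (simp add: sum.union_disjoint)
  also have "F {} = chrom ?N la (M - 1)"
    using chrom_eq_class_sum[OF la refl, of "M - 1"] by (simp add: F_def up_edges_def)
  also have "sum F ((\<lambda>i. {i}) ` ?V)
      = xvar M * (\<Sum>i\<in>?V. qvar ^ (?N - i - conj_part la i)
                       * chrom (?N - 1) (remove_line n m la i) (M - 1))"
  proof -
    have "F {i} = xvar M * (qvar ^ (?N - i - conj_part la i)
        * chrom (?N - 1) (remove_line n m la i) (M - 1))" if "i \<in> ?V" for i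
      unfolding F_def up_edges_vertex[OF la refl that] chrom_remove_line[OF la that]
      by (simp add: ac_simps)
    then show ?thesis
      by (simp add: sum.reindex sum_distrib_left)
  qed
  also have "sum F (?pair ` cells la)
      = (xvar M)\<^sup>2 * (\<Sum>(i, j)\<in>cells la. qvar ^ (i - 1 + (?N - j - conj_part la j))
                       * chrom (?N - 2) (remove_cell_lines la (i, j)) (M - 1))"
  proof -
    have "F (?pair c) = (xvar M)\<^sup>2 * (case c of (i, j) \<Rightarrow> qvar ^ (i - 1 + (?N - j - conj_part la j))
        * chrom (?N - 2) (remove_cell_lines la (i, j)) (M - 1))" if c: "c \<in> cells la" for c
    proof -
      obtain i j where ij: "c = (i, j)" "(i, j) \<in> cells la" using c by (cases c) auto
      have "card {j, ?N + 1 - i} = 2" using two(1)[OF ij(2)] by simp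
      then show ?thesis
        unfolding ij(1) prod.case F_def up_edges_cell[OF la refl ij(2)]
          chrom_remove_cell_lines[OF la ij(2)]
        by (simp add: ac_simps)
    qed
    then show ?thesis
      unfolding sum.reindex[OF inj] comp_def sum_distrib_left by (intro sum.cong refl)
  qed
  finally show ?thesis by (simp only: add.assoc)
qed

end
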